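(* Let $A$ be a Banach algebra. Then the following hold. (1) If $A^{***}A^{**}\subseteq A^*$, then $\tilde{Z}_1^\ell(A^{**})=Z_1(A^{**})=A^{**}$. (2) If $A^{**}A^{***}\subseteq A^*$, then $\tilde{Z}_1^r(A^{**})=A^{**}$.
   Context: $A^*,A^{**},A^{***}$ are the successive dual spaces of $A$; $A$ is identified with its canonical image in $A^{**}$ and $A^*$ with its canonical image in $A^{***}$. For $a,b\in A$, $a'\in A^*$, $a'',b''\in A^{**}$ put $\langle a'a,b\rangle=\langle a',ab\rangle$, $\langle a''a',a\rangle=\langle a'',a'a\rangle$, and define the first Arens product on $A^{**}$ by $\langle a''b'',a'\rangle=\langle a'',b''a'\rangle$. $A^{***}$ is the dual bimodule of $A^{**}$: $\langle a'''a'',b''\rangle=\langle a''',a''b''\rangle$ and $\langle a''a''',b''\rangle=\langle a''',b''a''\rangle$. For sets $X,Y$, $XY=\{xy: x\in X,\ y\in Y\}$. $Z_1(A^{**})=\{a''\in A^{**}: b''\mapsto a''b''\text{ is weak}^*\text{-weak}^*\text{ continuous on }A^{**}\}$. $\tilde Z_1^\ell(A^{**})=\{a''\in A^{**}: b''\mapsto a''b''\text{ is weak}^*\text{-to-weak continuous on }A^{**}\}$. $\tilde Z_1^r(A^{**})=\{a''\in A^{**}: b''\mapsto b''a''\text{ is weak}^*\text{-to-weak continuous on }A^{**}\}$. Here weak$^*$ means $\sigma(A^{**},A^* )$ and weak means $\sigma(A^{**},A^{***})$. *)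

theory Defs
  imports "HOL-Analysis.Analysis" "HOL-Library.Function_Algebras"
begin

(* A real_normed_field is isomorphic to the reals or to the complex numbers (Gelfand-Mazur), so
   'k covers exactly the two usual scalar fields. No unit is assumed in the algebra. *)
locale banach_algebra_over = vector_space s
  for s :: "'k::real_normed_field \<Rightarrow> 'a::{real_normed_algebra, banach} \<Rightarrow> 'a" +
  assumes scale_of_real: "s (of_real r) x = r *\<^sub>R x"
    and norm_scale: "norm (s c x) = norm c * norm x"
    and mult_scale_left: "s c x * y = s c (x * y)"
    and mult_scale_right: "x * s c y = s c (x * y)"

(* The continuous dual of a normed space with carrier V, scalar multiplication s and norm N.
   Functionals are total HOL functions, normalised to be 0 off V; with pointwise operations they
   form a vector space again, so the construction can be iterated. *)
definition dual_space ::
  "('k::real_normed_field \<Rightarrow> 'v::ab_group_add \<Rightarrow> 'v) \<Rightarrow> ('v \<Rightarrow> real) \<Rightarrow> 'v set \<Rightarrow> ('v \<Rightarrow> 'k) set" where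
  "dual_space s N V =
    {f. (\<forall>x. x \<notin> V \<longrightarrow> f x = 0)
      \<and> (\<forall>x\<in>V. \<forall>y\<in>V. f (x + y) = f x + f y)
      \<and> (\<forall>c. \<forall>x\<in>V. f (s c x) = c * f x)
      \<and> (\<exists>C. \<forall>x\<in>V. norm (f x) \<le> C * N x)}"

definition dual_norm :: "('v \<Rightarrow> real) \<Rightarrow> 'v set \<Rightarrow> ('v \<Rightarrow> 'k::real_normed_field) \<Rightarrow> real" where
  "dual_norm N V f = (SUP x\<in>{x\<in>V. N x \<le> 1}. norm (f x))"

definition fun_scale :: "'k::real_normed_field \<Rightarrow> ('v \<Rightarrow> 'k) \<Rightarrow> 'v \<Rightarrow> 'k" where
  "fun_scale c f = (\<lambda>x. c * f x)"

type_synonym ('k, 'a) functional2 = "('a \<Rightarrow> 'k) \<Rightarrow> 'k"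
type_synonym ('k, 'a) functional3 = "('k, 'a) functional2 \<Rightarrow> 'k"

definition dual1 ::
  "('k::real_normed_field \<Rightarrow> 'a::{real_normed_algebra, banach} \<Rightarrow> 'a) \<Rightarrow> ('a \<Rightarrow> 'k) set" where
  "dual1 s = dual_space s norm UNIV"

definition dual2 ::
  "('k::real_normed_field \<Rightarrow> 'a::{real_normed_algebra, banach} \<Rightarrow> 'a) \<Rightarrow> ('k, 'a) functional2 set" where
  "dual2 s = dual_space fun_scale (dual_norm norm UNIV) (dual1 s)"

definition dual3 ::
  "('k::real_normed_field \<Rightarrow> 'a::{real_normed_algebra, banach} \<Rightarrow> 'a) \<Rightarrow> ('k, 'a) functional3 set" where
  "dual3 s = dual_space fun_scale (dual_norm (dual_norm norm UNIV) (dual1 s)) (dual2 s)"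

(* a' a *)
definition act1 :: "('a::times \<Rightarrow> 'k) \<Rightarrow> 'a \<Rightarrow> 'a \<Rightarrow> 'k" where
  "act1 a' a = (\<lambda>b. a' (a * b))"

(* a'' a' *)
definition act2 :: "('k, 'a::times) functional2 \<Rightarrow> ('a \<Rightarrow> 'k) \<Rightarrow> 'a \<Rightarrow> 'k" where
  "act2 a'' a' = (\<lambda>a. a'' (act1 a' a))"

(* the first Arens product a'' b'' *)
definition arens ::
  "('k::real_normed_field \<Rightarrow> 'a::{real_normed_algebra, banach} \<Rightarrow> 'a) \<Rightarrow>
    ('k, 'a) functional2 \<Rightarrow> ('k, 'a) functional2 \<Rightarrow> ('k, 'a) functional2" where
  "arens s a'' b'' = (\<lambda>a'. if a' \<in> dual1 s then a'' (act2 b'' a') else 0)"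

(* a''' a'' *)
definition right_act3 ::
  "('k::real_normed_field \<Rightarrow> 'a::{real_normed_algebra, banach} \<Rightarrow> 'a) \<Rightarrow>
    ('k, 'a) functional3 \<Rightarrow> ('k, 'a) functional2 \<Rightarrow> ('k, 'a) functional3" where
  "right_act3 s a''' a'' = (\<lambda>b''. if b'' \<in> dual2 s then a''' (arens s a'' b'') else 0)"

(* a'' a''' *)
definition left_act3 ::
  "('k::real_normed_field \<Rightarrow> 'a::{real_normed_algebra, banach} \<Rightarrow> 'a) \<Rightarrow>
    ('k, 'a) functional2 \<Rightarrow> ('k, 'a) functional3 \<Rightarrow> ('k, 'a) functional3" where
  "left_act3 s a'' a''' = (\<lambda>b''. if b'' \<in> dual2 s then a''' (arens s b'' a'') else 0)"

(* the canonical embedding of the dual into the third dual *)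
definition canonical ::
  "('k::real_normed_field \<Rightarrow> 'a::{real_normed_algebra, banach} \<Rightarrow> 'a) \<Rightarrow>
    ('a \<Rightarrow> 'k) \<Rightarrow> ('k, 'a) functional3" where
  "canonical s a' = (\<lambda>a''. if a'' \<in> dual2 s then a'' a' else 0)"

(* sigma(X, F): the coarsest topology on X making all members of F continuous (for nonempty F) *)
definition initial_topology :: "'x set \<Rightarrow> ('x \<Rightarrow> 'k::topological_space) set \<Rightarrow> 'x topology" where
  "initial_topology X F = topology_generated_by {{x\<in>X. f x \<in> U} | f U. f \<in> F \<and> open U}"

definition weak_star_topology ::
  "('k::real_normed_field \<Rightarrow> 'a::{real_normed_algebra, banach} \<Rightarrow> 'a) \<Rightarrow>
    ('k, 'a) functional2 topology" where
  "weak_star_topology s = initial_topology (dual2 s) ((\<lambda>a' a''. a'' a') ` dual1 s)"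

definition weak_topology ::
  "('k::real_normed_field \<Rightarrow> 'a::{real_normed_algebra, banach} \<Rightarrow> 'a) \<Rightarrow>
    ('k, 'a) functional2 topology" where
  "weak_topology s = initial_topology (dual2 s) (dual3 s)"

definition Z1 ::
  "('k::real_normed_field \<Rightarrow> 'a::{real_normed_algebra, banach} \<Rightarrow> 'a) \<Rightarrow>
    ('k, 'a) functional2 set" where
  "Z1 s = {a'' \<in> dual2 s.
    continuous_map (weak_star_topology s) (weak_star_topology s) (\<lambda>b''. arens s a'' b'')}"

definition Z1_tilde_left ::
  "('k::real_normed_field \<Rightarrow> 'a::{real_normed_algebra, banach} \<Rightarrow> 'a) \<Rightarrow>
    ('k, 'a) functional2 set" where
  "Z1_tilde_left s = {a'' \<in> dual2 s.
    continuous_map (weak_star_topology s) (weak_topology s) (\<lambda>b''. arens s a'' b'')}"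

definition Z1_tilde_right ::
  "('k::real_normed_field \<Rightarrow> 'a::{real_normed_algebra, banach} \<Rightarrow> 'a) \<Rightarrow>
    ('k, 'a) functional2 set" where
  "Z1_tilde_right s = {a'' \<in> dual2 s.
    continuous_map (weak_star_topology s) (weak_topology s) (\<lambda>b''. arens s b'' a'')}"

end

theory Submission
  imports Defs
begin

text \<open>
  The hypotheses are continuity statements in disguise. A map into a space with an initial topology
  is continuous once each defining functional, composed with the map, is continuous. For the weak
  topology the defining functionals are the \<open>a'''\<close> in the third dual, and
  \<open>\<langle>a''', a'' b''\<rangle> = \<langle>a''' a'', b''\<rangle>\<close>. If \<open>a''' a''\<close> is the image of some
  \<open>a'\<close> in the first dual, this equals \<open>\<langle>b'', a'\<rangle>\<close>, which is weak* continuous in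
  \<open>b''\<close>; so left multiplication by \<open>a''\<close> is weak*-to-weak continuous. Right multiplication
  is treated in the same way through \<open>\<langle>a''', b'' a''\<rangle> = \<langle>a'' a''', b''\<rangle>\<close>.

  The equality with the ordinary topological centre holds because the weak topology is finer than the
  weak* topology, that is, because the canonical image of the first dual lies in the third dual.

  What remains is that the second dual is closed under the first Arens product. It rests on the chain
  \<open>\<parallel>a' a\<parallel> \<le> \<parallel>a'\<parallel> \<parallel>a\<parallel>\<close>, \<open>\<parallel>a'' a'\<parallel> \<le> \<parallel>a''\<parallel> \<parallel>a'\<parallel>\<close>,
  \<open>\<parallel>a'' b''\<parallel> \<le> \<parallel>a''\<parallel> \<parallel>b''\<parallel>\<close>, each link of which is an instance of the inequality
  \<open>\<parallel>f x\<parallel> \<le> \<parallel>f\<parallel> \<parallel>x\<parallel>\<close> for the supremum norm on a dual space.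
\<close>

section \<open>Norms on iterated dual spaces\<close>

text \<open>
  These properties of the carrier and its norm suffice to rescale a vector into the unit ball, and
  they pass to the dual space. Hence one inequality for functionals serves at every level of duality.
\<close>

locale norm_carrier =
  fixes s :: "'k::real_normed_field \<Rightarrow> 'v::ab_group_add \<Rightarrow> 'v" and N :: "'v \<Rightarrow> real" and V :: "'v set"
  assumes zero_mem: "0 \<in> V"
    and norm_zero: "N 0 = 0"
    and nonneg: "x \<in> V \<Longrightarrow> 0 \<le> N x"
    and scale_mem: "x \<in> V \<Longrightarrow> 0 \<le> r \<Longrightarrow> s (of_real r) x \<in> V"
    and norm_scale_le: "x \<in> V \<Longrightarrow> 0 \<le> r \<Longrightarrow> N (s (of_real r) x) \<le> r * N x"
begin

lemma functional_bdd_above: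
  assumes "f \<in> dual_space s N V"
  shows "bdd_above ((\<lambda>x. norm (f x)) ` {x \<in> V. N x \<le> 1})"
proof -
  obtain C where C: "\<forall>x\<in>V. norm (f x) \<le> C * N x"
    using assms by (auto simp: dual_space_def)
  have "norm (f x) \<le> \<bar>C\<bar>" if "x \<in> V" "N x \<le> 1" for x
  proof -
    have "norm (f x) \<le> C * N x" using C that by blast
    also have "\<dots> \<le> \<bar>C\<bar> * 1"
      using that nonneg[of x] by (intro mult_mono) auto
    finally show ?thesis by simp
  qed
  then show ?thesis by (auto intro!: bdd_aboveI)
qed

lemma dual_norm_nonneg:
  assumes "f \<in> dual_space s N V"
  shows "0 \<le> dual_norm N V f"
proof -
  have "norm (f 0) \<le> dual_norm N V f"
    unfolding dual_norm_def
    using zero_mem norm_zero by (intro cSUP_upper functional_bdd_above assms) auto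
  then show ?thesis using norm_ge_zero order_trans by blast
qed

lemma norm_functional_le:
  assumes "f \<in> dual_space s N V" "x \<in> V"
  shows "norm (f x) \<le> dual_norm N V f * N x"
proof (cases "N x = 0")
  case True
  then show ?thesis using assms by (force simp: dual_space_def)
next
  case False
  then have pos: "0 < N x" using nonneg[OF assms(2)] by simp
  define y where "y = s (of_real (1 / N x)) x"
  have "y \<in> V" unfolding y_def using pos assms by (intro scale_mem) auto
  moreover have "N y \<le> 1"
    unfolding y_def using pos norm_scale_le[OF assms(2), of "1 / N x"] by simp
  ultimately have "norm (f y) \<le> dual_norm N V f"
    unfolding dual_norm_def by (intro cSUP_upper functional_bdd_above assms) auto
  moreover have "f y = of_real (1 / N x) * f x"
    unfolding y_def using assms by (simp add: dual_space_def)
  ultimately have "norm (f x) / N x \<le> dual_norm N V f"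
    using pos by (simp add: norm_mult norm_divide)
  then show ?thesis using pos by (simp add: divide_simps)
qed

lemma dual_norm_le:
  assumes "0 \<le> K" "\<And>x. x \<in> V \<Longrightarrow> norm (f x) \<le> K * N x"
  shows "dual_norm N V f \<le> K"
  unfolding dual_norm_def
proof (rule cSUP_least)
  show "{x \<in> V. N x \<le> 1} \<noteq> {}" using zero_mem norm_zero by force
  fix x assume x: "x \<in> {x \<in> V. N x \<le> 1}"
  have "norm (f x) \<le> K * N x" using assms x by auto
  also have "\<dots> \<le> K" using assms(1) x by (simp add: mult_left_le)
  finally show "norm (f x) \<le> K" .
qed

end

lemma dual_spaceI:
  assumes "\<And>x. x \<notin> V \<Longrightarrow> f x = 0"
    and "\<And>x y. x \<in> V \<Longrightarrow> y \<in> V \<Longrightarrow> f (x + y) = f x + f y"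
    and "\<And>c x. x \<in> V \<Longrightarrow> f (s c x) = c * f x"
    and "\<And>x. x \<in> V \<Longrightarrow> norm (f x) \<le> C * N x"
  shows "f \<in> dual_space s N V"
  using assms unfolding dual_space_def by blast

lemma dual_space_add_closed:
  assumes "f \<in> dual_space s N V" "g \<in> dual_space s N V"
  shows "f + g \<in> dual_space s N V"
proof -
  obtain C D where "\<forall>x\<in>V. norm (f x) \<le> C * N x" "\<forall>x\<in>V. norm (g x) \<le> D * N x"
    using assms by (auto simp: dual_space_def)
  then have "norm ((f + g) x) \<le> (C + D) * N x" if "x \<in> V" for x
    using that by (auto simp: distrib_right intro!: norm_triangle_mono)
  then show ?thesis
    using assms by (intro dual_spaceI[where C = "C + D"]) (auto simp: dual_space_def algebra_simps)
qed

lemma dual_space_scale_closed: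
  assumes "f \<in> dual_space s N V"
  shows "fun_scale c f \<in> dual_space s N V"
proof -
  obtain C where "\<forall>x\<in>V. norm (f x) \<le> C * N x"
    using assms by (auto simp: dual_space_def)
  then have "norm (fun_scale c f x) \<le> (norm c * C) * N x" if "x \<in> V" for x
    using that by (auto simp: fun_scale_def norm_mult mult.assoc intro!: mult_left_mono)
  then show ?thesis
    using assms
    by (intro dual_spaceI[where C = "norm c * C"]) (auto simp: dual_space_def fun_scale_def algebra_simps)
qed

lemma (in norm_carrier) norm_carrier_dual:
  "norm_carrier fun_scale (dual_norm N V) (dual_space s N V)"
proof
  show zero: "0 \<in> dual_space s N V"
    by (rule dual_spaceI[where C = 0]) auto
  show "dual_norm N V (0 :: 'v \<Rightarrow> 'k) = 0"
    using dual_norm_nonneg[OF zero] dual_norm_le[of 0 "0 :: 'v \<Rightarrow> 'k"] by (simp add: order_antisym)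
  fix f and r :: real
  assume f: "f \<in> dual_space s N V"
  then show "0 \<le> dual_norm N V f" by (rule dual_norm_nonneg)
  assume r: "0 \<le> r"
  show "fun_scale (of_real r) f \<in> dual_space s N V"
    using f by (rule dual_space_scale_closed)
  show "dual_norm N V (fun_scale (of_real r) f) \<le> r * dual_norm N V f"
    using r dual_norm_nonneg[OF f] norm_functional_le[OF f]
    by (intro dual_norm_le) (auto simp: fun_scale_def norm_mult mult.assoc mult_left_mono)
qed

section \<open>The second dual is closed under the Arens product\<close>

context banach_algebra_over
begin

lemma norm_carrier_algebra: "norm_carrier s norm UNIV"
  by standard (auto simp: scale_of_real)

lemma norm_carrier_dual1: "norm_carrier fun_scale (dual_norm norm UNIV) (dual1 s)"
  unfolding dual1_def by (rule norm_carrier.norm_carrier_dual[OF norm_carrier_algebra])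

lemma norm_carrier_dual2:
  "norm_carrier fun_scale (dual_norm (dual_norm norm UNIV) (dual1 s)) (dual2 s)"
  unfolding dual2_def by (rule norm_carrier.norm_carrier_dual[OF norm_carrier_dual1])

lemma norm_dual1_le: "f \<in> dual1 s \<Longrightarrow> norm (f x) \<le> dual_norm norm UNIV f * norm x"
  using norm_carrier.norm_functional_le[OF norm_carrier_algebra] by (simp add: dual1_def)

lemmas dual1_norm_nonneg = norm_carrier.nonneg[OF norm_carrier_dual1]

lemmas dual2_norm_nonneg = norm_carrier.nonneg[OF norm_carrier_dual2]

lemma norm_dual2_le:
  "F \<in> dual2 s \<Longrightarrow> f \<in> dual1 s \<Longrightarrow>
    norm (F f) \<le> dual_norm (dual_norm norm UNIV) (dual1 s) F * dual_norm norm UNIV f"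
  using norm_carrier.norm_functional_le[OF norm_carrier_dual1] by (simp add: dual2_def)

lemmas dual1_norm_le = norm_carrier.dual_norm_le[OF norm_carrier_algebra]

lemma dual1_add: "f \<in> dual1 s \<Longrightarrow> f (x + y) = f x + f y"
  and dual1_scale: "f \<in> dual1 s \<Longrightarrow> f (s c x) = c * f x"
  by (auto simp: dual1_def dual_space_def)

lemma dual2_add: "F \<in> dual2 s \<Longrightarrow> f \<in> dual1 s \<Longrightarrow> g \<in> dual1 s \<Longrightarrow> F (f + g) = F f + F g"
  and dual2_scale: "F \<in> dual2 s \<Longrightarrow> f \<in> dual1 s \<Longrightarrow> F (fun_scale c f) = c * F f"
  by (auto simp: dual2_def dual_space_def)

lemma norm_act1_le:
  assumes "f \<in> dual1 s"
  shows "norm (act1 f a b) \<le> (dual_norm norm UNIV f * norm a) * norm b"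
proof -
  have "norm (act1 f a b) \<le> dual_norm norm UNIV f * norm (a * b)"
    unfolding act1_def by (rule norm_dual1_le[OF assms])
  also have "\<dots> \<le> dual_norm norm UNIV f * (norm a * norm b)"
    by (intro mult_left_mono norm_mult_ineq dual1_norm_nonneg assms)
  finally show ?thesis by (simp add: mult.assoc)
qed

lemma act1_mem_dual1:
  assumes "f \<in> dual1 s"
  shows "act1 f a \<in> dual1 s"
  unfolding dual1_def
  by (rule dual_spaceI[where C = "dual_norm norm UNIV f * norm a"])
    (use norm_act1_le[OF assms] assms in
      \<open>auto simp: act1_def distrib_left mult_scale_right dual1_add dual1_scale\<close>)

lemma norm_act2_le:
  assumes "F \<in> dual2 s" "f \<in> dual1 s"
  shows "norm (act2 F f a) \<le>
    (dual_norm (dual_norm norm UNIV) (dual1 s) F * dual_norm norm UNIV f) * norm a"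
proof -
  have "norm (act2 F f a) \<le>
      dual_norm (dual_norm norm UNIV) (dual1 s) F * dual_norm norm UNIV (act1 f a)"
    unfolding act2_def by (intro norm_dual2_le act1_mem_dual1 assms)
  also have "\<dots> \<le> dual_norm (dual_norm norm UNIV) (dual1 s) F * (dual_norm norm UNIV f * norm a)"
    by (intro mult_left_mono dual1_norm_le norm_act1_le dual2_norm_nonneg assms
        mult_nonneg_nonneg dual1_norm_nonneg norm_ge_zero)
  finally show ?thesis by (simp add: mult.assoc)
qed

lemma act2_mem_dual1:
  assumes "F \<in> dual2 s" "f \<in> dual1 s"
  shows "act2 F f \<in> dual1 s"
  unfolding dual1_def
proof (rule dual_spaceI[OF _ _ _ norm_act2_le[OF assms]])
  fix x y c
  have "act1 f (x + y) = act1 f x + act1 f y"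
    using assms by (auto simp: act1_def distrib_right dual1_add)
  then show "act2 F f (x + y) = act2 F f x + act2 F f y"
    using assms by (simp add: act2_def dual2_add act1_mem_dual1)
  have "act1 f (s c x) = fun_scale c (act1 f x)"
    using assms by (auto simp: act1_def fun_scale_def mult_scale_left dual1_scale)
  then show "act2 F f (s c x) = c * act2 F f x"
    using assms by (simp add: act2_def dual2_scale act1_mem_dual1)
qed simp

lemma arens_mem_dual2:
  assumes F: "F \<in> dual2 s" and G: "G \<in> dual2 s"
  shows "arens s F G \<in> dual2 s"
  unfolding dual2_def
proof (rule dual_spaceI)
  let ?n1 = "dual_norm norm UNIV"
  let ?n2 = "dual_norm ?n1 (dual1 s)"
  show "arens s F G f = 0" if "f \<notin> dual1 s" for f
    using that by (simp add: arens_def)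
  fix f assume f: "f \<in> dual1 s"
  show "arens s F G (f + g) = arens s F G f + arens s F G g" if g: "g \<in> dual1 s" for g
  proof -
    have sum: "f + g \<in> dual1 s"
      using f g unfolding dual1_def by (rule dual_space_add_closed)
    have "act1 (f + g) a = act1 f a + act1 g a" for a
      by (auto simp: act1_def)
    then have "act2 G (f + g) = act2 G f + act2 G g"
      using f g G by (auto simp: act2_def dual2_add act1_mem_dual1)
    then show ?thesis
      using f g F G sum by (simp add: arens_def dual2_add act2_mem_dual1)
  qed
  show "arens s F G (fun_scale c f) = c * arens s F G f" for c
  proof -
    have scaled: "fun_scale c f \<in> dual1 s"
      using f unfolding dual1_def by (rule dual_space_scale_closed)
    have "act1 (fun_scale c f) a = fun_scale c (act1 f a)" for a
      by (auto simp: act1_def fun_scale_def)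
    then have "act2 G (fun_scale c f) a = fun_scale c (act2 G f) a" for a
      using f G by (simp add: act2_def dual2_scale act1_mem_dual1) (simp add: fun_scale_def act2_def)
    then have "act2 G (fun_scale c f) = fun_scale c (act2 G f)" by blast
    then show ?thesis
      using f F G scaled by (simp add: arens_def dual2_scale act2_mem_dual1)
  qed
  show "norm (arens s F G f) \<le> (?n2 F * ?n2 G) * ?n1 f"
  proof -
    have "norm (arens s F G f) \<le> ?n2 F * ?n1 (act2 G f)"
      using f F G by (simp add: arens_def norm_dual2_le act2_mem_dual1)
    also have "\<dots> \<le> ?n2 F * (?n2 G * ?n1 f)"
      by (intro mult_left_mono dual1_norm_le norm_act2_le dual2_norm_nonneg f F G
          mult_nonneg_nonneg dual1_norm_nonneg)
    finally show ?thesis by (simp add: mult.assoc)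
  qed
qed

text \<open>The norm of \<open>a'\<close> bounds evaluation at \<open>a'\<close> on the second dual.\<close>

lemma canonical_mem_dual3:
  assumes f: "f \<in> dual1 s"
  shows "canonical s f \<in> dual3 s"
  unfolding dual3_def
proof (rule dual_spaceI[where C = "dual_norm norm UNIV f"])
  show "canonical s f F = 0" if "F \<notin> dual2 s" for F
    using that by (simp add: canonical_def)
  fix F assume F: "F \<in> dual2 s"
  show "canonical s f (F + G) = canonical s f F + canonical s f G" if G: "G \<in> dual2 s" for G
  proof -
    have "F + G \<in> dual2 s"
      using F G unfolding dual2_def by (rule dual_space_add_closed)
    then show ?thesis using F G by (simp add: canonical_def)
  qed
  show "canonical s f (fun_scale c F) = c * canonical s f F" for c
  proof -
    have "fun_scale c F \<in> dual2 s"
      using F unfolding dual2_def by (rule dual_space_scale_closed)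
    then show ?thesis using F by (simp add: canonical_def) (simp add: fun_scale_def)
  qed
  show "norm (canonical s f F) \<le>
      dual_norm norm UNIV f * dual_norm (dual_norm norm UNIV) (dual1 s) F"
    using norm_dual2_le[OF F f] F by (simp add: canonical_def mult.commute)
qed

end

section \<open>Continuity between initial topologies\<close>

lemma topspace_initial_topology:
  assumes "F \<noteq> {}"
  shows "topspace (initial_topology X F) = X"
  using assms unfolding initial_topology_def topology_generated_by_topspace
  by (auto intro: open_UNIV)

text \<open>
  Nonemptiness of \<open>G\<close> matters: the topology generated by the empty family has empty topspace
  instead of being indiscrete on \<open>Y\<close>.
\<close>

lemma continuous_map_initial_topology:
  assumes "G \<noteq> {}" and maps: "\<And>x. x \<in> X \<Longrightarrow> h x \<in> Y"
    and pullback: "\<And>g. g \<in> G \<Longrightarrow> \<exists>f\<in>F. \<forall>x\<in>X. g (h x) = f x"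
  shows "continuous_map (initial_topology X F) (initial_topology Y G) h"
proof -
  have "F \<noteq> {}" using assms(1) pullback by blast
  then have top: "topspace (initial_topology X F) = X" by (rule topspace_initial_topology)
  have "openin (initial_topology X F) (h -` {y \<in> Y. g y \<in> U} \<inter> X)"
    if g: "g \<in> G" and U: "open U" for g U
  proof -
    obtain f where f: "f \<in> F" "\<forall>x\<in>X. g (h x) = f x" using pullback[OF g] by blast
    have "h -` {y \<in> Y. g y \<in> U} \<inter> X = {x \<in> X. f x \<in> U}"
      using f maps by auto
    then show ?thesis
      unfolding initial_topology_def using f U by (auto intro!: topology_generated_by_Basis)
  qed
  moreover have "h ` X \<subseteq> topspace (initial_topology Y G)"
    using maps by (auto simp: topspace_initial_topology[OF assms(1)])
  ultimately show ?thesis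
    unfolding initial_topology_def[of Y G] continuous_on_generated_topo_iff top
      topology_generated_by_topspace
    by auto
qed

section \<open>Topological centres\<close>

context banach_algebra_over
begin

lemma zero_mem_dual1: "0 \<in> dual1 s"
  using norm_carrier.zero_mem[OF norm_carrier_dual1] .

lemma continuous_map_weak_star_to_weak:
  assumes maps: "\<And>F. F \<in> dual2 s \<Longrightarrow> h F \<in> dual2 s"
    and pullback: "\<And>\<phi>. \<phi> \<in> dual3 s \<Longrightarrow> \<exists>f\<in>dual1 s. \<forall>F\<in>dual2 s. \<phi> (h F) = F f"
  shows "continuous_map (weak_star_topology s) (weak_topology s) h"
  unfolding weak_star_topology_def weak_topology_def
  using pullback canonical_mem_dual3[OF zero_mem_dual1]
  by (intro continuous_map_initial_topology maps) auto

lemma continuous_map_weak_to_weak_star: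
  "continuous_map (weak_topology s) (weak_star_topology s) (\<lambda>F. F)"
  unfolding weak_star_topology_def weak_topology_def
proof (rule continuous_map_initial_topology)
  show "(\<lambda>a' a''. a'' a') ` dual1 s \<noteq> ({} :: ('k, 'a) functional3 set)" using zero_mem_dual1 by blast
  fix g :: "('k, 'a) functional3"
  assume "g \<in> (\<lambda>a' a''. a'' a') ` dual1 s"
  then obtain f where "f \<in> dual1 s" "g = (\<lambda>F. F f)" by blast
  then show "\<exists>\<phi>\<in>dual3 s. \<forall>F\<in>dual2 s. g F = \<phi> F"
    by (intro bexI[OF _ canonical_mem_dual3]) (auto simp: canonical_def)
qed

lemma Z1_tilde_left_subset_Z1: "Z1_tilde_left s \<subseteq> Z1 s"
  unfolding Z1_tilde_left_def Z1_def
  using continuous_map_compose[OF _ continuous_map_weak_to_weak_star] by (auto simp: comp_def)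

lemma Z1_tilde_left_eq_dual2:
  assumes hyp: "\<And>\<phi> F. \<phi> \<in> dual3 s \<Longrightarrow> F \<in> dual2 s \<Longrightarrow> right_act3 s \<phi> F \<in> canonical s ` dual1 s"
  shows "Z1_tilde_left s = dual2 s"
proof -
  have "continuous_map (weak_star_topology s) (weak_topology s) (arens s F)" if F: "F \<in> dual2 s" for F
  proof (rule continuous_map_weak_star_to_weak)
    fix \<phi> assume "\<phi> \<in> dual3 s"
    then obtain f where "f \<in> dual1 s" "right_act3 s \<phi> F = canonical s f"
      using hyp F by blast
    then show "\<exists>f\<in>dual1 s. \<forall>G\<in>dual2 s. \<phi> (arens s F G) = G f"
      by (intro bexI[of _ f]) (auto simp: right_act3_def canonical_def fun_eq_iff split: if_splits)
  qed (rule arens_mem_dual2[OF F])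
  then show ?thesis unfolding Z1_tilde_left_def by auto
qed

lemma Z1_tilde_right_eq_dual2:
  assumes hyp: "\<And>\<phi> F. \<phi> \<in> dual3 s \<Longrightarrow> F \<in> dual2 s \<Longrightarrow> left_act3 s F \<phi> \<in> canonical s ` dual1 s"
  shows "Z1_tilde_right s = dual2 s"
proof -
  have "continuous_map (weak_star_topology s) (weak_topology s) (\<lambda>G. arens s G F)"
    if F: "F \<in> dual2 s" for F
  proof (rule continuous_map_weak_star_to_weak)
    fix \<phi> assume "\<phi> \<in> dual3 s"
    then obtain f where "f \<in> dual1 s" "left_act3 s F \<phi> = canonical s f"
      using hyp F by blast
    then show "\<exists>f\<in>dual1 s. \<forall>G\<in>dual2 s. \<phi> (arens s G F) = G f"
      by (intro bexI[of _ f]) (auto simp: left_act3_def canonical_def fun_eq_iff split: if_splits)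
  qed (rule arens_mem_dual2[OF _ F])
  then show ?thesis unfolding Z1_tilde_right_def by auto
qed

end

theorem mainTheorem1:
  fixes s :: "'k::real_normed_field \<Rightarrow> 'a::{real_normed_algebra, banach} \<Rightarrow> 'a"
  assumes "banach_algebra_over s"
  shows "({right_act3 s a''' a'' | a''' a''. a''' \<in> dual3 s \<and> a'' \<in> dual2 s} \<subseteq> canonical s ` dual1 s
            \<longrightarrow> Z1_tilde_left s = Z1 s \<and> Z1 s = dual2 s)
       \<and> ({left_act3 s a'' a''' | a'' a'''. a'' \<in> dual2 s \<and> a''' \<in> dual3 s} \<subseteq> canonical s ` dual1 s
            \<longrightarrow> Z1_tilde_right s = dual2 s)"
proof (intro conjI[of "_ \<longrightarrow> _"] impI)
  interpret banach_algebra_over s by (rule assms)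
  {
    assume "{right_act3 s a''' a'' | a''' a''. a''' \<in> dual3 s \<and> a'' \<in> dual2 s} \<subseteq> canonical s ` dual1 s"
    then have "Z1_tilde_left s = dual2 s" by (intro Z1_tilde_left_eq_dual2) blast
    moreover have "Z1 s \<subseteq> dual2 s" by (auto simp: Z1_def)
    ultimately show "Z1_tilde_left s = Z1 s \<and> Z1 s = dual2 s"
      using Z1_tilde_left_subset_Z1 by blast
  }
  assume "{left_act3 s a'' a''' | a'' a'''. a'' \<in> dual2 s \<and> a''' \<in> dual3 s} \<subseteq> canonical s ` dual1 s"
  then show "Z1_tilde_right s = dual2 s" by (intro Z1_tilde_right_eq_dual2) blast
qed

end
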